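(* Let $\mathbb{F}_q$ be a finite field, let $a,b\in\mathbb{F}_q$ with $b\ne0$, let $n\ge1$, $t\ge 2$ be integers and let $f_1,\dots,f_{t-1}\in\mathbb{F}_q[x]$. For $k\ge 1$ let $C_k(a,b)$ be the linear code over $\mathbb{F}_q$ with generator matrix $(I_k\ f_1(T_k(a,b,b))\ \cdots\ f_{t-1}(T_k(a,b,b)))$, and let $C'_k(a,b)$ be the linear code over $\mathbb{F}_q$ with generator matrix $(I_k\ f_1(T'_k(a,b,b))\ \cdots\ f_{t-1}(T'_k(a,b,b)))$. Then: (1) $C'_{2n}(a,b)$ is Euclidean LCD if and only if $C_n(a,b)$ is Euclidean LCD. (2) $C'_{2n+1}(a,b)$ is Euclidean LCD if and only if $C_n(a,b)$ and $C_{n+1}(a,b)$ are both Euclidean LCD.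
   Context: $T_k(a,b,c)$ denotes the $k\times k$ tridiagonal Toeplitz matrix with all diagonal entries $a$, all entries in positions $(i+1,i)$ equal to $b$, all entries in positions $(i,i+1)$ equal to $c$, and all other entries $0$. $T'_k(a,b,c)$ denotes the $k\times k$ Toeplitz matrix with all diagonal entries $a$, all entries in positions $(i+2,i)$ equal to $b$, all entries in positions $(i,i+2)$ equal to $c$, and all other entries $0$ (so $T'_1=(a)$ and $T'_2=aI_2$). $I_k$ is the identity matrix. For a linear code $C\subseteq\mathbb{F}_q^N$, the Euclidean dual is $C^{\perp_E}=\{y\in\mathbb{F}_q^N:\sum_i x_iy_i=0 \text{ for all } x\in C\}$, and $C$ is Euclidean LCD if $C\cap C^{\perp_E}=\{0\}$. The code with generator matrix $G$ is the row space of $G$. *)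

theory Defs
  imports "Jordan_Normal_Form.VS_Connect"
begin

text \<open>Matrix positions are counted from 0, as usual for \<^typ>\<open>'a mat\<close>. In both families,
  b is the entry below the diagonal and c the entry above it.\<close>

definition toeplitz_tridiag :: "nat \<Rightarrow> 'a \<Rightarrow> 'a \<Rightarrow> 'a \<Rightarrow> 'a::zero mat" where
  "toeplitz_tridiag k a b c =
     mat k k (\<lambda>(i, j). if i = j then a else if i = j + 1 then b else if j = i + 1 then c else 0)"

definition toeplitz_tridiag' :: "nat \<Rightarrow> 'a \<Rightarrow> 'a \<Rightarrow> 'a \<Rightarrow> 'a::zero mat" where
  "toeplitz_tridiag' k a b c =
     mat k k (\<lambda>(i, j). if i = j then a else if i = j + 2 then b else if j = i + 2 then c else 0)"

text \<open>The value p(A) of a polynomial at a square matrix, that is, the sum of the matrices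
  \<open>coeff p m \<cdot>\<^sub>m A ^\<^sub>m m\<close>, written entrywise because matrices of variable size
  form no type class to which \<^const>\<open>sum\<close> would apply.\<close>

definition poly_mat :: "'a::comm_semiring_1 poly \<Rightarrow> 'a mat \<Rightarrow> 'a mat" where
  "poly_mat p A =
     mat (dim_row A) (dim_col A) (\<lambda>ij. \<Sum>m\<le>degree p. coeff p m * (A ^\<^sub>m m) $$ ij)"

text \<open>The matrix \<open>(I  f\<^sub>1(A)  \<dots>  f\<^sub>t\<^sub>-\<^sub>1(A))\<close> consisting of t square blocks, all of the size
  of A: column j lies in block \<open>j div k\<close>, where it is column \<open>j mod k\<close>.
  The value \<open>f 0\<close> is not used.\<close>

definition poly_gen_mat :: "nat \<Rightarrow> (nat \<Rightarrow> 'a::comm_semiring_1 poly) \<Rightarrow> 'a mat \<Rightarrow> 'a mat" where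
  "poly_gen_mat t f A = (let k = dim_row A in
     mat k (t * k) (\<lambda>(i, j).
       (if j div k = 0 then 1\<^sub>m k else poly_mat (f (j div k)) A) $$ (i, j mod k)))"

definition code_of_gen_mat :: "'a::field mat \<Rightarrow> 'a vec set" where
  "code_of_gen_mat G = vec_space.row_space (dim_col G) G"

text \<open>The library's orthogonal complement is taken with respect to the bilinear form
  \<open>x \<bullet> y = (\<Sum>i. x\<^sub>i * y\<^sub>i)\<close>, so it is the Euclidean dual code.\<close>

definition euclidean_dual :: "nat \<Rightarrow> 'a::field vec set \<Rightarrow> 'a vec set" where
  "euclidean_dual N C = vec_module.orthogonal_complement N C"

definition euclidean_LCD :: "nat \<Rightarrow> 'a::field vec set \<Rightarrow> bool" where
  "euclidean_LCD N C \<longleftrightarrow> C \<inter> euclidean_dual N C = {0\<^sub>v N}"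

definition toeplitz_code ::
    "nat \<Rightarrow> (nat \<Rightarrow> 'a::field poly) \<Rightarrow> nat \<Rightarrow> 'a \<Rightarrow> 'a \<Rightarrow> 'a vec set" where
  "toeplitz_code t f k a b = code_of_gen_mat (poly_gen_mat t f (toeplitz_tridiag k a b b))"

definition toeplitz_code' ::
    "nat \<Rightarrow> (nat \<Rightarrow> 'a::field poly) \<Rightarrow> nat \<Rightarrow> 'a \<Rightarrow> 'a \<Rightarrow> 'a vec set" where
  "toeplitz_code' t f k a b = code_of_gen_mat (poly_gen_mat t f (toeplitz_tridiag' k a b b))"

end

theory Submission
  imports Defs
begin

text \<open>Sorting the positions \<open>0, \<dots>, k - 1\<close> by parity turns \<open>T'\<^sub>k\<close> into the block
  diagonal matrix with blocks \<open>T\<^sub>p\<close> and \<open>T\<^sub>q\<close>, where \<open>p = \<lceil>k/2\<rceil>\<close> and \<open>q = \<lfloor>k/2\<rfloor>\<close>.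
  This shape survives products, transposition and polynomials, hence passes to the Gram matrix
  \<open>G G\<^sup>T\<close> of the generator matrix. As \<open>G\<close> contains an identity block, the code is LCD
  iff \<open>G G\<^sup>T\<close> has trivial kernel, and the kernel splits along the two blocks.\<close>

section \<open>Indices by parity\<close>

text \<open>The hypotheses make \<open>p\<close> the number of even and \<open>q\<close> the number
  of odd indices below \<open>p + q\<close>, so the sum can be sorted by parity.\<close>

lemma sum_parity_split:
  fixes g :: "nat \<Rightarrow> 'a::comm_monoid_add"
  assumes "q \<le> p" "p \<le> q + 1"
  shows "(\<Sum>r<p + q. g r) = (\<Sum>s<p. g (2 * s)) + (\<Sum>s<q. g (2 * s + 1))"
proof -
  have double: "(\<Sum>r<2 * q. g r) = (\<Sum>s<q. g (2 * s)) + (\<Sum>s<q. g (2 * s + 1))"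
    by (induction q) (simp_all add: ac_simps)
  consider "p = q" "p + q = 2 * q" | "p = Suc q" "p + q = Suc (2 * q)" using assms by linarith
  then show ?thesis
  proof cases
    case 1
    then show ?thesis using double by (simp only:)
  next
    \<comment> \<open>The additional last index \<open>2 * q\<close> is even and extends the first
      sum.\<close>
    case 2
    then show ?thesis using double by (simp only: sum.lessThan_Suc ac_simps)
  qed
qed

lemma div2_less_parity:
  fixes i p q :: nat
  assumes "q \<le> p" "p \<le> q + 1" "i < p + q"
  shows "even i \<Longrightarrow> i div 2 < p" and "odd i \<Longrightarrow> i div 2 < q"
  using assms by presburger+

lemma double_less_parity:
  fixes s p q :: nat
  assumes "q \<le> p" "p \<le> q + 1"
  shows "s < p \<Longrightarrow> 2 * s < p + q" and "s < q \<Longrightarrow> Suc (2 * s) < p + q"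
  using assms by linarith+

section \<open>Interleaved matrices\<close>

text \<open>For square blocks of sizes \<open>p\<close> and \<open>q\<close> as above, this is the
  block diagonal matrix diag(P, Q) conjugated by the permutation that sorts positions by parity. The
  entrywise form avoids permutation matrices.\<close>

definition interleave :: "'a::zero mat \<Rightarrow> 'a mat \<Rightarrow> 'a mat" where
  "interleave P Q = mat (dim_row P + dim_row Q) (dim_col P + dim_col Q) (\<lambda>(i, j).
     if even i \<and> even j then P $$ (i div 2, j div 2)
     else if odd i \<and> odd j then Q $$ (i div 2, j div 2) else 0)"

context
  fixes p q :: nat
  assumes balanced: "q \<le> p" "p \<le> q + 1"
begin

lemma interleave_carrier:
  assumes "P \<in> carrier_mat p p" "Q \<in> carrier_mat q q"
  shows "interleave P Q \<in> carrier_mat (p + q) (p + q)"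
  using assms by (auto simp: interleave_def)

lemma interleave_one: "interleave (1\<^sub>m p) (1\<^sub>m q) = 1\<^sub>m (p + q)"
proof (rule eq_matI)
  fix i j assume "i < dim_row (1\<^sub>m (p + q))" "j < dim_col (1\<^sub>m (p + q))"
  then show "interleave (1\<^sub>m p) (1\<^sub>m q) $$ (i, j) = 1\<^sub>m (p + q) $$ (i, j)"
    \<comment> \<open>An index is determined by its parity and its half, so within one parity class
      equal halves mean equal indices.\<close>
    using div2_less_parity[OF balanced, of i] div2_less_parity[OF balanced, of j]
      bit_eq_rec[of i j]
    by (auto simp: interleave_def)
qed (simp_all add: interleave_def)

text \<open>A term of the inner sum survives only if its index has the parity of both
  \<open>i\<close> and \<open>j\<close>. What remains is an entry of the product of the even or of
  the odd blocks, or zero if the parities of \<open>i\<close> and \<open>j\<close> differ.\<close>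

lemma interleave_mult:
  fixes P P' Q Q' :: "'a::comm_semiring_1 mat"
  assumes "P \<in> carrier_mat p p" "P' \<in> carrier_mat p p"
    and "Q \<in> carrier_mat q q" "Q' \<in> carrier_mat q q"
  shows "interleave P Q * interleave P' Q' = interleave (P * P') (Q * Q')"
proof (rule eq_matI)
  fix i j assume "i < dim_row (interleave (P * P') (Q * Q'))"
    "j < dim_col (interleave (P * P') (Q * Q'))"
  then have ij: "i < p + q" "j < p + q" using assms by (auto simp: interleave_def)
  have "(interleave P Q * interleave P' Q') $$ (i, j)
      = (\<Sum>r<p + q. interleave P Q $$ (i, r) * interleave P' Q' $$ (r, j))"
    using assms ij by (simp add: interleave_def scalar_prod_def atLeast0LessThan)
  also have "\<dots> = interleave (P * P') (Q * Q') $$ (i, j)"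
    using assms ij div2_less_parity[OF balanced, of i] div2_less_parity[OF balanced, of j]
    by (simp add: sum_parity_split[OF balanced] interleave_def scalar_prod_def
        atLeast0LessThan double_less_parity[OF balanced])
  finally show "(interleave P Q * interleave P' Q') $$ (i, j)
      = interleave (P * P') (Q * Q') $$ (i, j)" .
qed (use assms in \<open>simp_all add: interleave_def\<close>)

lemma interleave_transpose:
  assumes "P \<in> carrier_mat p p" "Q \<in> carrier_mat q q"
  shows "(interleave P Q)\<^sup>T = interleave P\<^sup>T Q\<^sup>T"
  using assms div2_less_parity[OF balanced]
  by (intro eq_matI) (auto simp: interleave_def)

lemma interleave_pow:
  fixes P Q :: "'a::comm_semiring_1 mat"
  assumes "P \<in> carrier_mat p p" "Q \<in> carrier_mat q q"
  shows "interleave P Q ^\<^sub>m m = interleave (P ^\<^sub>m m) (Q ^\<^sub>m m)"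
proof (induction m)
  case 0
  then show ?case using assms interleave_carrier[OF assms] by (simp add: interleave_one)
next
  case (Suc m)
  then show ?case using assms by (simp add: interleave_mult)
qed

text \<open>Powers interleave, and their linear combination is formed entry by entry, with zeros at
  mixed parity in every term.\<close>

lemma interleave_poly_mat:
  fixes P Q :: "'a::comm_semiring_1 mat"
  assumes "P \<in> carrier_mat p p" "Q \<in> carrier_mat q q"
  shows "poly_mat h (interleave P Q) = interleave (poly_mat h P) (poly_mat h Q)"
proof (rule eq_matI)
  fix i j assume "i < dim_row (interleave (poly_mat h P) (poly_mat h Q))"
    "j < dim_col (interleave (poly_mat h P) (poly_mat h Q))"
  then have ij: "i < p + q" "j < p + q" using assms by (auto simp: interleave_def poly_mat_def)
  then have "poly_mat h (interleave P Q) $$ (i, j)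
      = (\<Sum>m\<le>degree h. coeff h m * interleave (P ^\<^sub>m m) (Q ^\<^sub>m m) $$ (i, j))"
    using interleave_carrier[OF assms] interleave_pow[OF assms] by (simp add: poly_mat_def)
  also have "\<dots> = interleave (poly_mat h P) (poly_mat h Q) $$ (i, j)"
    using assms ij div2_less_parity[OF balanced, of i] div2_less_parity[OF balanced, of j]
    by (simp add: poly_mat_def interleave_def)
  finally show "poly_mat h (interleave P Q) $$ (i, j)
      = interleave (poly_mat h P) (poly_mat h Q) $$ (i, j)" .
qed (use assms in \<open>simp_all add: interleave_def poly_mat_def\<close>)

text \<open>A vector is the same as the pair of its even and odd parts, and the matrix acts on the
  two parts separately. The kernel is therefore the product of the two kernels.\<close>

lemma interleave_kernel_trivial:
  fixes P Q :: "'a::comm_semiring_1 mat"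
  assumes P: "P \<in> carrier_mat p p" and Q: "Q \<in> carrier_mat q q"
  shows "(\<forall>v\<in>carrier_vec (p + q). interleave P Q *\<^sub>v v = 0\<^sub>v (p + q) \<longrightarrow> v = 0\<^sub>v (p + q)) \<longleftrightarrow>
    (\<forall>v\<in>carrier_vec p. P *\<^sub>v v = 0\<^sub>v p \<longrightarrow> v = 0\<^sub>v p) \<and>
    (\<forall>v\<in>carrier_vec q. Q *\<^sub>v v = 0\<^sub>v q \<longrightarrow> v = 0\<^sub>v q)"
    (is "?L \<longleftrightarrow> ?P \<and> ?Q")
proof -
  \<comment> \<open>Inverse of the splitting of a vector into its even and odd parts.\<close>
  define join :: "'a vec \<Rightarrow> 'a vec \<Rightarrow> 'a vec" where
    "join v w = vec (p + q) (\<lambda>i. if even i then v $ (i div 2) else w $ (i div 2))" for v w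
  have join_even: "join v w $ (2 * s) = v $ s" if "s < p" for v w s
    using that double_less_parity[OF balanced] by (simp add: join_def)
  have join_odd: "join v w $ Suc (2 * s) = w $ s" if "s < q" for v w s
    using that double_less_parity[OF balanced] by (simp add: join_def)
  have join_zero: "join v w = 0\<^sub>v (p + q) \<longleftrightarrow> v = 0\<^sub>v p \<and> w = 0\<^sub>v q"
    if "v \<in> carrier_vec p" "w \<in> carrier_vec q" for v w
  proof
    assume 0: "join v w = 0\<^sub>v (p + q)"
    have "v $ s = 0" if "s < p" for s
      using join_even[OF that, of v w] that double_less_parity[OF balanced] by (simp add: 0)
    moreover have "w $ s = 0" if "s < q" for s
      using join_odd[OF that, of v w] that double_less_parity[OF balanced] by (simp add: 0)
    ultimately show "v = 0\<^sub>v p \<and> w = 0\<^sub>v q" using that by auto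
  next
    assume "v = 0\<^sub>v p \<and> w = 0\<^sub>v q"
    then show "join v w = 0\<^sub>v (p + q)"
      using div2_less_parity[OF balanced] by (intro eq_vecI) (auto simp: join_def)
  qed
  have mult_join: "interleave P Q *\<^sub>v join v w = join (P *\<^sub>v v) (Q *\<^sub>v w)"
    if "v \<in> carrier_vec p" "w \<in> carrier_vec q" for v w
  proof (rule eq_vecI)
    fix i assume "i < dim_vec (join (P *\<^sub>v v) (Q *\<^sub>v w))"
    then have i: "i < p + q" by (simp add: join_def)
    have "(interleave P Q *\<^sub>v join v w) $ i
        = (\<Sum>r<p + q. interleave P Q $$ (i, r) * join v w $ r)"
      using i P Q by (simp add: interleave_def join_def scalar_prod_def atLeast0LessThan)
    also have "\<dots> = join (P *\<^sub>v v) (Q *\<^sub>v w) $ i"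
      using i P Q that div2_less_parity[OF balanced, of i]
      by (simp add: sum_parity_split[OF balanced] join_even join_odd)
        (simp add: interleave_def join_def scalar_prod_def atLeast0LessThan
          double_less_parity[OF balanced])
    finally show "(interleave P Q *\<^sub>v join v w) $ i = join (P *\<^sub>v v) (Q *\<^sub>v w) $ i" .
  qed (use P Q in \<open>simp add: interleave_def join_def\<close>)
  have join_surj: "\<exists>v\<in>carrier_vec p. \<exists>w\<in>carrier_vec q. u = join v w"
    if "u \<in> carrier_vec (p + q)" for u
    using that div2_less_parity[OF balanced]
    by (intro bexI[of _ "vec p (\<lambda>s. u $ (2 * s))"] bexI[of _ "vec q (\<lambda>s. u $ (2 * s + 1))"] eq_vecI)
      (auto simp: join_def)
  have join_carrier: "join v w \<in> carrier_vec (p + q)" for v w by (simp add: join_def)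
  have "?L \<longleftrightarrow> (\<forall>v\<in>carrier_vec p. \<forall>w\<in>carrier_vec q.
      interleave P Q *\<^sub>v join v w = 0\<^sub>v (p + q) \<longrightarrow> join v w = 0\<^sub>v (p + q))"
    using join_surj join_carrier by metis
  also have "\<dots> \<longleftrightarrow> (\<forall>v\<in>carrier_vec p. \<forall>w\<in>carrier_vec q.
      P *\<^sub>v v = 0\<^sub>v p \<and> Q *\<^sub>v w = 0\<^sub>v q \<longrightarrow> v = 0\<^sub>v p \<and> w = 0\<^sub>v q)"
    using P Q by (simp add: mult_join join_zero)
  also have "\<dots> \<longleftrightarrow> ?P \<and> ?Q"
  proof -
    \<comment> \<open>To isolate one block, the other component is taken to be zero, which always
      lies in its kernel.\<close>
    have "P *\<^sub>v 0\<^sub>v p = 0\<^sub>v p" "Q *\<^sub>v 0\<^sub>v q = 0\<^sub>v q" using P Q by auto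
    then show ?thesis by (metis zero_carrier_vec)
  qed
  finally show ?thesis .
qed

end

section \<open>Toeplitz matrices as interleavings\<close>

lemma toeplitz_tridiag_carrier: "toeplitz_tridiag k a b c \<in> carrier_mat k k"
  by (simp add: toeplitz_tridiag_def)

lemma toeplitz_tridiag'_carrier: "toeplitz_tridiag' k a b c \<in> carrier_mat k k"
  by (simp add: toeplitz_tridiag'_def)

text \<open>Positions at distance 2 have the same parity and adjacent halves, so the two outer bands
  become the sub- and superdiagonals within each parity class.\<close>

lemma toeplitz_tridiag'_eq_interleave:
  assumes "q \<le> p" "p \<le> q + 1"
  shows "toeplitz_tridiag' (p + q) a b c
    = interleave (toeplitz_tridiag p a b c) (toeplitz_tridiag q a b c)"
    (is "?T' = ?I")
proof (rule eq_matI)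
  have dims: "dim_row ?I = p + q" "dim_col ?I = p + q"
    using interleave_carrier[OF assms toeplitz_tridiag_carrier[of p a b c]
        toeplitz_tridiag_carrier[of q a b c]] by auto
  then show "dim_row ?T' = dim_row ?I" "dim_col ?T' = dim_col ?I"
    using carrier_matD[OF toeplitz_tridiag'_carrier, of "p + q" a b c] by simp_all
  fix i j assume "i < dim_row ?I" "j < dim_col ?I"
  then have ij: "i < p + q" "j < p + q" by (simp_all only: dims)
  have half: "x = y + 2 \<longleftrightarrow> even x = even y \<and> x div 2 = y div 2 + 1"
    "x = y \<longleftrightarrow> even x = even y \<and> x div 2 = y div 2" for x y :: nat
    using bit_eq_rec[of x "y + 2"] bit_eq_rec[of x y] by simp_all
  have "?T' $$ (i, j) = (if even i = even j then
      if i div 2 = j div 2 then a else if i div 2 = j div 2 + 1 then b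
      else if j div 2 = i div 2 + 1 then c else 0 else 0)"
    \<comment> \<open>The instance with \<open>i\<close> and \<open>j\<close> exchanged handles the
      band above the diagonal.\<close>
    unfolding toeplitz_tridiag'_def index_mat(1)[OF ij] prod.case half[of i j] half(1)[of j i]
    by (cases "even i = even j") auto
  also have "\<dots> = ?I $$ (i, j)"
    using ij div2_less_parity[OF assms, of i] div2_less_parity[OF assms, of j]
    by (simp add: interleave_def toeplitz_tridiag_def)
  finally show "?T' $$ (i, j) = ?I $$ (i, j)" .
qed

section \<open>LCD codes and Gram matrices\<close>

text \<open>Massey's criterion in kernel form. Codewords are the vectors
  \<open>G\<^sup>T *\<^sub>v u\<close>, and such a word is orthogonal to the whole code exactly when
  the Gram matrix kills \<open>u\<close>. Injectivity of the encoding turns zero codewords into zero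
  messages.\<close>

lemma euclidean_LCD_iff_gram_kernel_trivial:
  fixes G :: "'a::field mat"
  assumes G: "G \<in> carrier_mat k N"
    and inj: "\<And>u. u \<in> carrier_vec k \<Longrightarrow> G\<^sup>T *\<^sub>v u = 0\<^sub>v N \<Longrightarrow> u = 0\<^sub>v k"
  shows "euclidean_LCD N (code_of_gen_mat G) \<longleftrightarrow>
    (\<forall>u\<in>carrier_vec k. (G * G\<^sup>T) *\<^sub>v u = 0\<^sub>v k \<longrightarrow> u = 0\<^sub>v k)"
proof -
  have Gt: "G\<^sup>T \<in> carrier_mat N k" using G by simp
  have code: "code_of_gen_mat G = {G\<^sup>T *\<^sub>v u | u. u \<in> carrier_vec k}"
    using G by (auto simp: code_of_gen_mat_def vec_space.row_space_eq[OF G])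
  have dual: "G\<^sup>T *\<^sub>v u \<in> euclidean_dual N (code_of_gen_mat G) \<longleftrightarrow> (G * G\<^sup>T) *\<^sub>v u = 0\<^sub>v k"
    if u: "u \<in> carrier_vec k" for u
  proof -
    let ?g = "(G * G\<^sup>T) *\<^sub>v u"
    have g: "?g \<in> carrier_vec k"
      by (rule mult_mat_vec_carrier[OF mult_carrier_mat[OF G Gt] u])
    have "(G\<^sup>T *\<^sub>v u) \<bullet> (G\<^sup>T *\<^sub>v w) = ?g \<bullet> w" if w: "w \<in> carrier_vec k" for w
    proof -
      \<comment> \<open>The factors are swapped so that the transpose acting on \<open>w\<close> can
        be moved across the product.\<close>
      have "(G\<^sup>T *\<^sub>v u) \<bullet> (G\<^sup>T *\<^sub>v w) = (G\<^sup>T *\<^sub>v w) \<bullet> (G\<^sup>T *\<^sub>v u)"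
        using G u w by (intro comm_scalar_prod[of _ N]) auto
      also have "\<dots> = w \<bullet> (G *\<^sub>v (G\<^sup>T *\<^sub>v u))"
        using G u w by (intro transpose_vec_mult_scalar) auto
      also have "\<dots> = w \<bullet> ?g" using G u by simp
      also have "\<dots> = ?g \<bullet> w" using w g by (rule comm_scalar_prod)
      finally show ?thesis .
    qed
    moreover have "G\<^sup>T *\<^sub>v u \<in> carrier_vec N" by (rule mult_mat_vec_carrier[OF Gt u])
    ultimately have "G\<^sup>T *\<^sub>v u \<in> euclidean_dual N (code_of_gen_mat G)
        \<longleftrightarrow> (\<forall>w\<in>carrier_vec k. ?g \<bullet> w = 0)"
      unfolding euclidean_dual_def vec_module.orthogonal_complement_def code by fastforce
    also have "\<dots> \<longleftrightarrow> ?g = 0\<^sub>v k"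
    proof
      \<comment> \<open>Nondegeneracy: the unit vectors read off the coordinates of
        \<open>?g\<close>.\<close>
      assume *: "\<forall>w\<in>carrier_vec k. ?g \<bullet> w = 0"
      show "?g = 0\<^sub>v k"
      proof (rule eq_vecI)
        fix i assume "i < dim_vec (0\<^sub>v k :: 'a vec)"
        then show "?g $ i = 0\<^sub>v k $ i"
          using *[rule_format, of "unit_vec k i"] g scalar_prod_right_unit[of i k ?g] by simp
      qed (use G in simp)
    qed auto
    finally show ?thesis .
  qed
  have zero': "G\<^sup>T *\<^sub>v 0\<^sub>v k = 0\<^sub>v N" using Gt by auto
  moreover have "G *\<^sub>v 0\<^sub>v N = 0\<^sub>v k" using G by auto
  ultimately have zero: "(G * G\<^sup>T) *\<^sub>v 0\<^sub>v k = 0\<^sub>v k"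
    by (simp add: assoc_mult_mat_vec[OF G Gt])
  \<comment> \<open>LCD demands equality with the zero space; with this inclusion only the other one
    remains to be characterized.\<close>
  have "0\<^sub>v N \<in> code_of_gen_mat G \<inter> euclidean_dual N (code_of_gen_mat G)"
  proof -
    have "G\<^sup>T *\<^sub>v 0\<^sub>v k \<in> code_of_gen_mat G"
      unfolding code using zero_carrier_vec by blast
    then show ?thesis using dual[OF zero_carrier_vec] zero by (simp add: zero')
  qed
  then have "euclidean_LCD N (code_of_gen_mat G) \<longleftrightarrow> (\<forall>u\<in>carrier_vec k.
      G\<^sup>T *\<^sub>v u \<in> euclidean_dual N (code_of_gen_mat G) \<longrightarrow> G\<^sup>T *\<^sub>v u = 0\<^sub>v N)"
    unfolding euclidean_LCD_def code by blast
  also have "\<dots> \<longleftrightarrow> (\<forall>u\<in>carrier_vec k. (G * G\<^sup>T) *\<^sub>v u = 0\<^sub>v k \<longrightarrow> u = 0\<^sub>v k)"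
    by (intro ball_cong refl) (use dual inj zero' zero in metis)
  finally show ?thesis .
qed

section \<open>Gram matrix of the block generator matrix\<close>

definition gen_block :: "(nat \<Rightarrow> 'a::comm_semiring_1 poly) \<Rightarrow> 'a mat \<Rightarrow> nat \<Rightarrow> 'a mat" where
  "gen_block f A l = (if l = 0 then 1\<^sub>m (dim_row A) else poly_mat (f l) A)"

text \<open>The Gram matrix of \<open>poly_gen_mat t f A\<close>, written blockwise: only square
  matrices of the size of \<open>A\<close> occur, to which the interleaving lemmas apply.\<close>

definition gram_mat :: "nat \<Rightarrow> (nat \<Rightarrow> 'a::comm_semiring_1 poly) \<Rightarrow> 'a mat \<Rightarrow> 'a mat" where
  "gram_mat t f A = mat (dim_row A) (dim_row A)
     (\<lambda>ij. \<Sum>l<t. (gen_block f A l * (gen_block f A l)\<^sup>T) $$ ij)"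

lemma gen_block_carrier: "A \<in> carrier_mat k k \<Longrightarrow> gen_block f A l \<in> carrier_mat k k"
  by (auto simp: gen_block_def poly_mat_def)

lemma poly_gen_mat_carrier: "A \<in> carrier_mat k k \<Longrightarrow> poly_gen_mat t f A \<in> carrier_mat k (t * k)"
  by (auto simp: poly_gen_mat_def Let_def)

lemma index_less_mult:
  fixes l t r k :: nat
  assumes "l < t" "r < k"
  shows "r + l * k < t * k"
proof -
  have "r + l * k < Suc l * k" using assms by simp
  also have "\<dots> \<le> t * k" using assms by (intro mult_le_mono1) simp
  finally show ?thesis .
qed

lemma poly_gen_mat_index:
  assumes "A \<in> carrier_mat k k" "i < k" "l < t" "r < k"
  shows "poly_gen_mat t f A $$ (i, r + l * k) = gen_block f A l $$ (i, r)"
  using assms index_less_mult[of l t r k]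
  by (auto simp: poly_gen_mat_def gen_block_def Let_def)

text \<open>The sum over all \<open>t * k\<close> columns is cut into \<open>t\<close> runs of
  length \<open>k\<close>, one for each block.\<close>

lemma poly_gen_mat_mult_transpose:
  assumes A: "A \<in> carrier_mat k k"
  shows "poly_gen_mat t f A * (poly_gen_mat t f A)\<^sup>T = gram_mat t f A"
proof (rule eq_matI)
  let ?G = "poly_gen_mat t f A"
  fix i j assume "i < dim_row (gram_mat t f A)" "j < dim_col (gram_mat t f A)"
  then have ij: "i < k" "j < k" using A by (auto simp: gram_mat_def)
  have "(?G * ?G\<^sup>T) $$ (i, j) = (\<Sum>c<t * k. ?G $$ (i, c) * ?G $$ (j, c))"
    using poly_gen_mat_carrier[OF A, of t f] ij by (simp add: scalar_prod_def atLeast0LessThan)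
  also have "\<dots> = (\<Sum>l<t. \<Sum>c = l * k..<l * k + k. ?G $$ (i, c) * ?G $$ (j, c))"
    by (rule sum.nat_group[symmetric])
  also have "\<dots> = (\<Sum>l<t. \<Sum>r<k. gen_block f A l $$ (i, r) * gen_block f A l $$ (j, r))"
  proof (rule sum.cong[OF refl])
    fix l assume "l \<in> {..<t}"
    then show "(\<Sum>c = l * k..<l * k + k. ?G $$ (i, c) * ?G $$ (j, c))
        = (\<Sum>r<k. gen_block f A l $$ (i, r) * gen_block f A l $$ (j, r))"
      \<comment> \<open>Column \<open>c\<close> of the run is reindexed as \<open>r + l * k\<close>,
        with \<open>r\<close> counted inside block \<open>l\<close>.\<close>
      using sum.shift_bounds_nat_ivl[of "\<lambda>c. ?G $$ (i, c) * ?G $$ (j, c)" 0 "l * k" k] ij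
      by (simp add: poly_gen_mat_index[OF A] atLeast0LessThan add.commute[of k])
  qed
  also have "\<dots> = gram_mat t f A $$ (i, j)"
    using A ij gen_block_carrier[OF A, of f]
    by (simp add: gram_mat_def scalar_prod_def atLeast0LessThan carrier_matD[OF gen_block_carrier[OF A]])
  finally show "(?G * ?G\<^sup>T) $$ (i, j) = gram_mat t f A $$ (i, j)" .
qed (use A poly_gen_mat_carrier[OF A, of t f] in \<open>auto simp: gram_mat_def\<close>)

text \<open>Block 0 is the identity, so the message \<open>u\<close> reappears as the first
  \<open>k\<close> coordinates of its codeword.\<close>

lemma poly_gen_mat_transpose_inj:
  fixes A :: "'a::comm_semiring_1 mat"
  assumes A: "A \<in> carrier_mat k k" and t: "t > 0" and u: "u \<in> carrier_vec k"
    and 0: "(poly_gen_mat t f A)\<^sup>T *\<^sub>v u = 0\<^sub>v (t * k)"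
  shows "u = 0\<^sub>v k"
proof (rule eq_vecI)
  let ?G = "poly_gen_mat t f A"
  fix r assume "r < dim_vec (0\<^sub>v k :: 'a vec)"
  then have r: "r < k" by simp
  \<comment> \<open>Instance \<open>l = 0\<close>: since \<open>t > 0\<close>, block 0 is
    present.\<close>
  have rt: "r < t * k" using index_less_mult[OF t r] by simp
  have "col ?G r = unit_vec k r"
  proof (rule eq_vecI)
    fix i assume "i < dim_vec (unit_vec k r :: 'a vec)"
    then show "col ?G r $ i = unit_vec k r $ i"
      using poly_gen_mat_index[OF A _ t r, of i f] poly_gen_mat_carrier[OF A, of t f] A rt r
      by (simp add: gen_block_def unit_vec_def)
  qed (use A in \<open>simp add: poly_gen_mat_def Let_def\<close>)
  then have "(?G\<^sup>T *\<^sub>v u) $ r = u $ r"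
    using poly_gen_mat_carrier[OF A, of t f] rt r u by simp
  then show "u $ r = 0\<^sub>v k $ r" using 0 r rt by simp
qed (use u in simp)

lemma poly_code_LCD_iff:
  assumes A: "A \<in> carrier_mat k k" and t: "t > 0"
  shows "euclidean_LCD (t * k) (code_of_gen_mat (poly_gen_mat t f A)) \<longleftrightarrow>
    (\<forall>u\<in>carrier_vec k. gram_mat t f A *\<^sub>v u = 0\<^sub>v k \<longrightarrow> u = 0\<^sub>v k)"
  using euclidean_LCD_iff_gram_kernel_trivial[OF poly_gen_mat_carrier[OF A]
      poly_gen_mat_transpose_inj[OF A t]]
  by (simp only: poly_gen_mat_mult_transpose[OF A])

text \<open>Every block is the identity or a polynomial value, hence interleaves; so do its
  transpose, their product, and the sum over blocks.\<close>

lemma gram_mat_interleave: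
  assumes pq: "q \<le> p" "p \<le> q + 1"
    and P: "P \<in> carrier_mat p p" and Q: "Q \<in> carrier_mat q q"
  shows "gram_mat t f (interleave P Q) = interleave (gram_mat t f P) (gram_mat t f Q)"
proof -
  have block: "gen_block f (interleave P Q) l = interleave (gen_block f P l) (gen_block f Q l)" for l
    using P Q interleave_carrier[OF pq P Q]
    by (simp add: gen_block_def interleave_one[OF pq] interleave_poly_mat[OF pq P Q])
  have prod: "gen_block f (interleave P Q) l * (gen_block f (interleave P Q) l)\<^sup>T
      = interleave (gen_block f P l * (gen_block f P l)\<^sup>T) (gen_block f Q l * (gen_block f Q l)\<^sup>T)" for l
    using gen_block_carrier[OF P, of f l] gen_block_carrier[OF Q, of f l]
    by (simp add: block interleave_transpose[OF pq] interleave_mult[OF pq])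
  show ?thesis
  proof (rule eq_matI)
    fix i j assume "i < dim_row (interleave (gram_mat t f P) (gram_mat t f Q))"
      "j < dim_col (interleave (gram_mat t f P) (gram_mat t f Q))"
    then have ij: "i < p + q" "j < p + q" using P Q by (auto simp: interleave_def gram_mat_def)
    then show "gram_mat t f (interleave P Q) $$ (i, j)
        = interleave (gram_mat t f P) (gram_mat t f Q) $$ (i, j)"
      using P Q interleave_carrier[OF pq P Q]
        div2_less_parity[OF pq, of i] div2_less_parity[OF pq, of j]
        carrier_matD[OF gen_block_carrier[OF P]] carrier_matD[OF gen_block_carrier[OF Q]]
      \<comment> \<open>Products are rewritten while \<open>interleave\<close> is still folded; its
        entries are compared afterwards.\<close>
      by (simp add: gram_mat_def prod) (simp add: interleave_def)
  qed (use P Q in \<open>auto simp: interleave_def gram_mat_def\<close>)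
qed

section \<open>Splitting of the LCD property\<close>

text \<open>Treats both parities of the length at once: \<open>p = q\<close> is the even case and
  \<open>p = q + 1\<close> the odd one.\<close>

lemma toeplitz_code'_LCD_iff:
  fixes a b :: "'a::field"
  assumes pq: "q \<le> p" "p \<le> q + 1" and t: "t > 0"
  shows "euclidean_LCD (t * (p + q)) (toeplitz_code' t f (p + q) a b) \<longleftrightarrow>
    euclidean_LCD (t * p) (toeplitz_code t f p a b) \<and>
    euclidean_LCD (t * q) (toeplitz_code t f q a b)"
proof -
  note T = toeplitz_tridiag_carrier
  have gram: "gram_mat t f (toeplitz_tridiag k a b b) \<in> carrier_mat k k" for k
    by (simp add: gram_mat_def toeplitz_tridiag_def)
  show ?thesis
    unfolding toeplitz_code'_def toeplitz_code_def toeplitz_tridiag'_eq_interleave[OF pq]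
      poly_code_LCD_iff[OF T t] poly_code_LCD_iff[OF interleave_carrier[OF pq T T] t]
      gram_mat_interleave[OF pq T T]
    by (rule interleave_kernel_trivial[OF pq gram gram])
qed

theorem theorem4p12:
  fixes a b :: "'a::{field, finite}"
    and n t :: nat
    and f :: "nat \<Rightarrow> 'a poly"
  assumes "b \<noteq> 0" and "n \<ge> 1" and "t \<ge> 2"
  shows "(euclidean_LCD (t * (2 * n)) (toeplitz_code' t f (2 * n) a b) \<longleftrightarrow>
            euclidean_LCD (t * n) (toeplitz_code t f n a b)) \<and>
         (euclidean_LCD (t * (2 * n + 1)) (toeplitz_code' t f (2 * n + 1) a b) \<longleftrightarrow>
            euclidean_LCD (t * n) (toeplitz_code t f n a b) \<and>
            euclidean_LCD (t * (n + 1)) (toeplitz_code t f (n + 1) a b))"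
proof -
  \<comment> \<open>The sizes are brought into the form \<open>p + q\<close>; in the even case both
    conjuncts then coincide.\<close>
  have even: "2 * n = n + n" and odd: "2 * n + 1 = (n + 1) + n" by simp_all
  show ?thesis
    unfolding even
    \<comment> \<open>The odd size already reads \<open>n + n + 1\<close> here, so the equation is
      adapted to that form.\<close>
    unfolding odd[unfolded even]
    using toeplitz_code'_LCD_iff[of n n t f a b] toeplitz_code'_LCD_iff[of n "n + 1" t f a b] assms(3)
    by auto
qed

end
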